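(* On the sub-monoid of graphs with even Euler characteristic, the Fredholm characteristic is multiplicative: if $G,H$ are finite simple graphs with $\chi(G)$ and $\chi(H)$ even, then $\psi(G+H)=\psi(G)\psi(H)$. In particular this holds for spheres, so that $\psi$, extended by $\psi(-G)=1/\psi(G)$, is a character (a group homomorphism to $\{-1,1\}$) on the sphere group.
   Context: The Whitney complex of a finite simple graph has as simplices the vertex sets of its non-empty complete subgraphs. The Euler characteristic is $\chi(G)=\sum_{x}(-1)^{\dim(x)}$, the sum over simplices of the Whitney complex, $\dim(x)=|x|-1$. The connection graph $G'$ has these simplices as vertices, two distinct ones being adjacent if they intersect. The Fredholm characteristic is $\psi(G)=\det(1+A(G'))$, with $A(G')$ the adjacency matrix of $G'$; by the known unimodularity theorem $\psi(G)=\prod_x(-1)^{\dim(x)}$. The (Zykov) join $G+H$ is the disjoint union of $G$ and $H$ with all edges between a vertex of $G$ and a vertex of $H$ added. The unit sphere $S(x)$ of a vertex is the subgraph induced on its neighbors. A graph is contractible if it is $K_1$, or (inductively) if it has a vertex $x$ such that both $S(x)$ and the graph with $x$ removed are contractible. The empty graph $0$ is the only $(-1)$-sphere; for $d\ge0$ a $d$-sphere is a finite simple graph in which every unit sphere is a $(d-1)$-sphere and such that removing a vertex from it renders the remaining graph contractible. Spheres of all dimensions $\ge -1$ (up to isomorphism) form a commutative monoid under the join with neutral element $0$; the sphere group is its Grothendieck group, i.e. classes of formal differences $A-B$ with $A-B\sim C-D$ if $A+D+K=B+C+K$ for some sphere $K$. *)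

theory Defs
  imports
    "Graph_Theory.Graph_Theory"
    "Jordan_Normal_Form.Determinant"
    "HOL-Algebra.Coset"
begin

text \<open>
  A finite simple graph is a \<^locale>\<open>pair_graph\<close>: a finite loop-free symmetric arc relation
  on a finite vertex set, possibly empty.
\<close>

subsection \<open>Basic constructions\<close>

definition empty_graph :: "'a pair_pre_digraph" where
  "empty_graph = \<lparr>pverts = {}, parcs = {}\<rparr>"

definition pair_induce :: "'a pair_pre_digraph \<Rightarrow> 'a set \<Rightarrow> 'a pair_pre_digraph" where
  "pair_induce G S = \<lparr>pverts = S, parcs = {(u, v) \<in> parcs G. u \<in> S \<and> v \<in> S}\<rparr>"

lemma with_proj_pair_induce: "with_proj (pair_induce G S) = with_proj G \<restriction> S"
  by (auto simp: pair_induce_def with_proj_def induce_subgraph_def)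

definition unit_sphere :: "'a pair_pre_digraph \<Rightarrow> 'a \<Rightarrow> 'a pair_pre_digraph" where
  "unit_sphere G x = pair_induce G {y. (x, y) \<in> parcs G}"

definition remove_vertex :: "'a pair_pre_digraph \<Rightarrow> 'a \<Rightarrow> 'a pair_pre_digraph" where
  "remove_vertex G x = pair_induce G (pverts G - {x})"

lemma with_proj_remove_vertex:
  assumes "pair_graph G"
  shows "with_proj (remove_vertex G x) = pre_digraph.del_vert (with_proj G) x"
proof -
  interpret pair_graph G by fact
  show ?thesis
    by (auto simp: remove_vertex_def pair_induce_def with_proj_def pre_digraph.del_vert_def
        dest: in_arcsD1 in_arcsD2)
qed

definition graph_join :: "'a pair_pre_digraph \<Rightarrow> 'b pair_pre_digraph \<Rightarrow> ('a + 'b) pair_pre_digraph"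
  where
  "graph_join G H =
    \<lparr>pverts = pverts G <+> pverts H,
     parcs = map_prod Inl Inl ` parcs G \<union> map_prod Inr Inr ` parcs H
       \<union> (Inl ` pverts G) \<times> (Inr ` pverts H) \<union> (Inr ` pverts H) \<times> (Inl ` pverts G)\<rparr>"

subsection \<open>Whitney complex, Euler characteristic and Fredholm characteristic\<close>

definition simplices :: "'a pair_pre_digraph \<Rightarrow> 'a set set" where
  "simplices G = {x. x \<noteq> {} \<and> x \<subseteq> pverts G \<and> (\<forall>u\<in>x. \<forall>v\<in>x. u \<noteq> v \<longrightarrow> (u, v) \<in> parcs G)}"

definition simplex_dim :: "'a set \<Rightarrow> nat" where
  "simplex_dim x = card x - 1"

definition euler_char :: "'a pair_pre_digraph \<Rightarrow> int" where
  "euler_char G = (\<Sum>x\<in>simplices G. (-1) ^ simplex_dim x)"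

definition connection_graph :: "'a pair_pre_digraph \<Rightarrow> 'a set pair_pre_digraph" where
  "connection_graph G =
    \<lparr>pverts = simplices G,
     parcs = {(x, y). x \<in> simplices G \<and> y \<in> simplices G \<and> x \<noteq> y \<and> x \<inter> y \<noteq> {}}\<rparr>"

definition adjacency_mat :: "'a list \<Rightarrow> 'a pair_pre_digraph \<Rightarrow> real mat" where
  "adjacency_mat vs G =
    mat (length vs) (length vs) (\<lambda>(i, j). if (vs ! i, vs ! j) \<in> parcs G then 1 else 0)"

definition vertex_enum :: "'a pair_pre_digraph \<Rightarrow> 'a list" where
  "vertex_enum G = (SOME vs. distinct vs \<and> set vs = pverts G)"

text \<open>
  The determinant does not depend on the chosen enumeration of the simplices; this is lemma
  \<open>fredholm_char_eq\<close> below.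
\<close>

definition fredholm_char :: "'a pair_pre_digraph \<Rightarrow> real" where
  "fredholm_char G =
    det (1\<^sub>m (card (simplices G))
       + adjacency_mat (vertex_enum (connection_graph G)) (connection_graph G))"

lemma det_simultaneous_permutation:
  fixes f :: "nat \<Rightarrow> nat \<Rightarrow> real"
  assumes p: "p permutes {0..<n}"
  shows "det (mat n n (\<lambda>(i, j). f (p i) (p j))) = det (mat n n (\<lambda>(i, j). f i j))"
proof -
  let ?A = "mat n n (\<lambda>(i, j). f i j)"
  let ?B = "mat n n (\<lambda>(i, j). f i (p j))"
  have lt: "p i < n" if "i < n" for i
    using permutes_in_image[OF p, of i] that by simp
  have s: "signof p * signof p = (1 :: real)"
    by (simp add: sign_def)
  have "det (mat n n (\<lambda>(i, j). ?B $$ (p i, j))) = signof p * det ?B"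
    by (rule det_permute_rows[OF _ p]) simp
  moreover have "mat n n (\<lambda>(i, j). ?B $$ (p i, j)) = mat n n (\<lambda>(i, j). f (p i) (p j))"
    by (rule eq_matI) (auto simp: lt)
  moreover have "det (mat n n (\<lambda>(i, j). transpose_mat ?A $$ (p i, j)))
      = signof p * det (transpose_mat ?A)"
    by (rule det_permute_rows[OF _ p]) simp
  moreover have "mat n n (\<lambda>(i, j). transpose_mat ?A $$ (p i, j)) = transpose_mat ?B"
    by (rule eq_matI) (auto simp: lt)
  moreover have "det (transpose_mat ?A) = det ?A" "det (transpose_mat ?B) = det ?B"
    by (rule det_transpose[of _ n]; simp)+
  ultimately show ?thesis
    using s by (simp add: mult.assoc[symmetric])
qed

lemma det_adjacency_enum:
  assumes "distinct vs" "distinct ws" "set vs = set ws"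
  shows "det (1\<^sub>m (length vs) + adjacency_mat vs G) = det (1\<^sub>m (length ws) + adjacency_mat ws G)"
proof -
  have "mset vs = mset ws"
    using assms by (simp add: set_eq_iff_mset_eq_distinct)
  then obtain p where p: "p permutes {..<length ws}" "permute_list p ws = vs"
    by (rule mset_eq_permutation)
  have len: "length vs = length ws"
    using p(2) by auto
  let ?n = "length ws"
  define f :: "nat \<Rightarrow> nat \<Rightarrow> real" where
    "f i j = (if i = j then 1 else 0) + (if (ws ! i, ws ! j) \<in> parcs G then 1 else 0)" for i j
  have p': "p permutes {0..<?n}"
    using p(1) by (simp add: atLeast0LessThan)
  have vs: "vs ! i = ws ! p i" if "i < ?n" for i
    using permute_list_nth[OF p(1) that] p(2) by simp
  have inj: "p i = p j \<longleftrightarrow> i = j" for i j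
    using permutes_inj[OF p'] by (auto dest: injD)
  have "1\<^sub>m (length vs) + adjacency_mat vs G = mat ?n ?n (\<lambda>(i, j). f (p i) (p j))"
    by (rule eq_matI) (auto simp: adjacency_mat_def len f_def vs inj)
  moreover have "1\<^sub>m (length ws) + adjacency_mat ws G = mat ?n ?n (\<lambda>(i, j). f i j)"
    by (rule eq_matI) (auto simp: adjacency_mat_def f_def)
  ultimately show ?thesis
    using det_simultaneous_permutation[OF p'] by simp
qed

lemma fredholm_char_eq:
  assumes "distinct xs" "set xs = simplices G"
  shows "fredholm_char G = det (1\<^sub>m (length xs) + adjacency_mat xs (connection_graph G))"
proof -
  let ?ws = "vertex_enum (connection_graph G)"
  have *: "distinct ?ws \<and> set ?ws = pverts (connection_graph G)"
    unfolding vertex_enum_def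
    by (rule someI[of _ xs]) (use assms in \<open>simp add: connection_graph_def\<close>)
  hence ws: "distinct ?ws" "set ?ws = simplices G"
    by (simp_all add: connection_graph_def)
  have "length ?ws = card (simplices G)"
    using ws distinct_card by metis
  then show ?thesis
    unfolding fredholm_char_def
    using det_adjacency_enum[of xs ?ws "connection_graph G"] assms ws by simp
qed

subsection \<open>Contractible graphs and spheres\<close>

inductive graph_contractible :: "'a pair_pre_digraph \<Rightarrow> bool" where
  K1: "pair_graph G \<Longrightarrow> card (pverts G) = 1 \<Longrightarrow> graph_contractible G"
| step: "pair_graph G \<Longrightarrow> x \<in> pverts G \<Longrightarrow> graph_contractible (unit_sphere G x) \<Longrightarrow>
    graph_contractible (remove_vertex G x) \<Longrightarrow> graph_contractible G"

inductive dim_sphere :: "int \<Rightarrow> 'a pair_pre_digraph \<Rightarrow> bool" where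
  empty: "dim_sphere (-1) empty_graph"
| step: "0 \<le> d \<Longrightarrow> pair_graph G \<Longrightarrow> (\<And>x. x \<in> pverts G \<Longrightarrow> dim_sphere (d - 1) (unit_sphere G x)) \<Longrightarrow>
    \<exists>x\<in>pverts G. graph_contractible (remove_vertex G x) \<Longrightarrow> dim_sphere d G"

definition graph_sphere :: "'a pair_pre_digraph \<Rightarrow> bool" where
  "graph_sphere G \<longleftrightarrow> (\<exists>d. dim_sphere d G)"

subsection \<open>The monoid of spheres up to isomorphism and its Grothendieck group\<close>

text \<open>
  Every finite graph has an isomorphic copy with vertices in \<^typ>\<open>nat\<close>, so isomorphism classes
  are represented as sets of graphs on \<^typ>\<open>nat\<close>, also for graphs over other vertex types.
\<close>

definition iso_class :: "'a pair_pre_digraph \<Rightarrow> nat pair_pre_digraph set" where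
  "iso_class G = {H. digraph_iso (with_proj G) (with_proj H)}"

definition sphere_monoid :: "nat pair_pre_digraph set monoid" where
  "sphere_monoid =
    \<lparr>carrier = iso_class ` {G :: nat pair_pre_digraph. graph_sphere G},
     mult = (\<lambda>X Y. \<Union>G\<in>X. \<Union>H\<in>Y. iso_class (graph_join G H)),
     one = iso_class (empty_graph :: nat pair_pre_digraph)\<rparr>"

text \<open>The pair \<open>(a, b)\<close> stands for the formal difference of \<open>a\<close> and \<open>b\<close>.\<close>

definition grothendieck_rel :: "('a, 'm) monoid_scheme \<Rightarrow> ('a \<times> 'a) rel" where
  "grothendieck_rel M = {((a, b), (c, d)).
     a \<in> carrier M \<and> b \<in> carrier M \<and> c \<in> carrier M \<and> d \<in> carrier M \<and>
     (\<exists>k\<in>carrier M. a \<otimes>\<^bsub>M\<^esub> d \<otimes>\<^bsub>M\<^esub> k = b \<otimes>\<^bsub>M\<^esub> c \<otimes>\<^bsub>M\<^esub> k)}"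

definition formal_diff :: "('a, 'm) monoid_scheme \<Rightarrow> 'a \<Rightarrow> 'a \<Rightarrow> ('a \<times> 'a) set" where
  "formal_diff M a b = grothendieck_rel M `` {(a, b)}"

definition grothendieck_group :: "('a, 'm) monoid_scheme \<Rightarrow> ('a \<times> 'a) set monoid" where
  "grothendieck_group M =
    \<lparr>carrier = (carrier M \<times> carrier M) // grothendieck_rel M,
     mult = (\<lambda>X Y. \<Union>(a, b)\<in>X. \<Union>(c, d)\<in>Y. formal_diff M (a \<otimes>\<^bsub>M\<^esub> c) (b \<otimes>\<^bsub>M\<^esub> d)),
     one = formal_diff M \<one>\<^bsub>M\<^esub> \<one>\<^bsub>M\<^esub>\<rparr>"

abbreviation sphere_group ::
    "(nat pair_pre_digraph set \<times> nat pair_pre_digraph set) set monoid" where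
  "sphere_group \<equiv> grothendieck_group sphere_monoid"

definition sphere_diff :: "'a pair_pre_digraph \<Rightarrow> 'b pair_pre_digraph \<Rightarrow>
    (nat pair_pre_digraph set \<times> nat pair_pre_digraph set) set" where
  "sphere_diff G H = formal_diff sphere_monoid (iso_class G) (iso_class H)"

abbreviation sphere_elem :: "'a pair_pre_digraph \<Rightarrow>
    (nat pair_pre_digraph set \<times> nat pair_pre_digraph set) set" where
  "sphere_elem G \<equiv> sphere_diff G (empty_graph :: nat pair_pre_digraph)"

definition sign_group :: "real monoid" where
  "sign_group = \<lparr>carrier = {-1, 1}, mult = (*), one = 1\<rparr>"

text \<open>The extension of the Fredholm characteristic to formal differences of spheres.\<close>

definition fredholm_ext :: "(nat pair_pre_digraph set \<times> nat pair_pre_digraph set) set \<Rightarrow> real"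
  where
  "fredholm_ext X = (THE r. \<exists>(G :: nat pair_pre_digraph) (H :: nat pair_pre_digraph).
     graph_sphere G \<and> graph_sphere H \<and>
     X = sphere_diff G H \<and> r = fredholm_char G * (1 / fredholm_char H))"

end

(*
  Unimodularity comes from a factorisation of the matrix 1 + A(G'), whose (x, y) entry is 1 if the
  simplices x and y intersect and 0 otherwise. The non-empty subsets z of a non-empty set x \<inter> y
  satisfy \<Sum> (-1)^dim z = 1, so the matrix is Z^T D Z with Z the inclusion matrix of simplices and
  D = diag((-1)^dim z); listed by size, Z is unitriangular, hence \<psi>(G) = \<Prod> (-1)^dim x.
  The simplices of G + H are those of G, those of H and the unions x + y, the latter contributing
  \<Prod> -(-1)^(dim x + dim y), which is 1 if G and H have evenly many simplices; this parity is that
  of \<chi>. Deleting a vertex x removes 1 + |S(x)| simplices, so contractible graphs have oddly many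
  and spheres evenly many. Joins of spheres are spheres because joining anything to a
  contractible graph gives a contractible graph.
*)

theory Submission
  imports Defs
begin

section \<open>The Fredholm characteristic as a product over simplices\<close>

text \<open>The locale becomes a condition on two plain sets: tails and heads are the projections,
  and the arcs are finitely many because they lie in a finite product. The graph constructions below
  are verified through this form.\<close>

lemma pair_graph_iff:
  "pair_graph G \<longleftrightarrow>
    finite (pverts G) \<and> parcs G \<subseteq> pverts G \<times> pverts G \<and> sym (parcs G) \<and> irrefl (parcs G)"
  (is "_ \<longleftrightarrow> ?R")
proof
  assume "pair_graph G"
  then interpret pair_graph G .
  show ?R
    using pair_finite_verts pair_sym_arcs pair_no_loops
    by (fastforce simp: symmetric_def irrefl_def dest: in_arcsD1 in_arcsD2)
next
  assume ?R
  then show "pair_graph G"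
    by unfold_locales (auto simp: symmetric_def irrefl_def intro: finite_subset)
qed

lemma pair_graphD:
  assumes "pair_graph G"
  shows "finite (pverts G)"
    and "(u, v) \<in> parcs G \<Longrightarrow> u \<in> pverts G \<and> v \<in> pverts G"
    and "(u, v) \<in> parcs G \<Longrightarrow> (v, u) \<in> parcs G"
    and "(u, u) \<notin> parcs G"
  using assms by (auto simp: pair_graph_iff irrefl_def sym_def)

section \<open>Finiteness and heredity of simplices\<close>

lemma finite_simplices: "pair_graph G \<Longrightarrow> finite (simplices G)"
  using pair_graphD(1)[of G] by (auto simp: simplices_def intro: finite_subset[of _ "Pow (pverts G)"])

lemma finite_simplex: "pair_graph G \<Longrightarrow> x \<in> simplices G \<Longrightarrow> finite x"
  using pair_graphD(1)[of G] by (auto simp: simplices_def intro: finite_subset)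

lemma simplices_mono: "x \<in> simplices G \<Longrightarrow> z \<subseteq> x \<Longrightarrow> z \<noteq> {} \<Longrightarrow> z \<in> simplices G"
  by (simp add: simplices_def) blast

lemma simplices_nonempty: "x \<in> simplices G \<Longrightarrow> x \<noteq> {}"
  by (simp add: simplices_def)

text \<open>Fix \<open>a\<close> in \<open>x\<close>: adding \<open>a\<close> to the subsets that
  avoid it pairs off all subsets and flips the sign.\<close>

lemma sum_Pow_minus_one_power_card:
  assumes "finite x" "x \<noteq> {}"
  shows "(\<Sum>z\<in>Pow x. (-1) ^ card z) = (0 :: real)"
proof -
  obtain a B where x: "x = insert a B" "a \<notin> B"
    using assms(2) by (metis ex_in_conv mk_disjoint_insert)
  with assms have B: "finite B" by simp
  have "(\<Sum>z\<in>Pow x. (-1) ^ card z)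
      = (\<Sum>z\<in>Pow B. (-1) ^ card z) + (\<Sum>z\<in>insert a ` Pow B. (-1 :: real) ^ card z)"
    unfolding x Pow_insert using B x by (intro sum.union_disjoint) auto
  also have "(\<Sum>z\<in>insert a ` Pow B. (-1 :: real) ^ card z) = (\<Sum>z\<in>Pow B. (-1) ^ card (insert a z))"
    using x by (subst sum.reindex) (auto simp: inj_on_def)
  also have "\<dots> = (\<Sum>z\<in>Pow B. - ((-1) ^ card z))"
    using x B by (intro sum.cong) (auto simp: card_insert_if finite_subset)
  finally show ?thesis
    by (simp add: sum_negf)
qed

text \<open>This is the Euler characteristic of a full simplex. The empty set contributes 1 to the
  vanishing sum over all subsets, so the rest has sum -1, and passing from cardinality to dimension
  changes every sign.\<close>

lemma sum_simplex_sign_subsets: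
  assumes "finite x" "x \<noteq> {}"
  shows "(\<Sum>z | z \<noteq> {} \<and> z \<subseteq> x. (-1) ^ simplex_dim z) = (1 :: real)"
proof -
  have "(\<Sum>z\<in>Pow x - {{}}. (-1) ^ card z) = (-1 :: real)"
    using sum_Pow_minus_one_power_card[OF assms] assms
    by (subst sum_diff1) auto
  moreover have "(-1 :: real) ^ simplex_dim z = - ((-1) ^ card z)" if "z \<in> Pow x - {{}}" for z
  proof -
    have "card z \<noteq> 0"
      using that assms by (auto simp: finite_subset)
    then show ?thesis
      unfolding simplex_dim_def by (cases "card z") auto
  qed
  moreover have "{z. z \<noteq> {} \<and> z \<subseteq> x} = Pow x - {{}}"
    by auto
  ultimately show ?thesis
    by (simp add: sum_negf)
qed

text \<open>In the factorisation Z^T D Z the matrix \<open>W\<close> is the product D Z. Both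
  triangular determinants are read off the diagonals, which consist of ones for \<open>Z\<close> and
  of the signs for \<open>W\<close>.\<close>

lemma fredholm_char_eq_prod:
  assumes G: "pair_graph G"
  shows "fredholm_char G = (\<Prod>x\<in>simplices G. (-1) ^ simplex_dim x)"
proof -
  \<comment> \<open>Sorting by cardinality puts every simplex after its proper subsets, which makes
    the inclusion matrix triangular.\<close>
  define xs where "xs = sort_key card (SOME xs. distinct xs \<and> set xs = simplices G)"
  obtain ys where "distinct ys \<and> set ys = simplices G"
    using finite_distinct_list[OF finite_simplices[OF G]] by blast
  then have "distinct (SOME xs. distinct xs \<and> set xs = simplices G)
      \<and> set (SOME xs. distinct xs \<and> set xs = simplices G) = simplices G"
    by (rule someI)
  then have xs: "distinct xs" "set xs = simplices G" and sorted: "sorted (map card xs)"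
    by (simp_all add: xs_def)
  define n where "n = length xs"
  define s where "s x = (-1 :: real) ^ simplex_dim x" for x :: "'a set"
  define Z where "Z = mat n n (\<lambda>(i, j). if xs ! i \<subseteq> xs ! j then 1 else 0 :: real)"
  define W where "W = mat n n (\<lambda>(i, j). if xs ! i \<subseteq> xs ! j then s (xs ! i) else 0)"
  have mem: "xs ! i \<in> simplices G" if "i < n" for i
    using that xs(2) n_def nth_mem by blast
  \<comment> \<open>A later simplex is at least as large, so inclusion in an earlier one would force
    equality, against distinctness of the list.\<close>
  have no_sub: "\<not> xs ! i \<subseteq> xs ! j" if "j < i" "i < n" for i j
  proof
    assume sub: "xs ! i \<subseteq> xs ! j"
    have "card (xs ! j) \<le> card (xs ! i)"
      using sorted_nth_mono[OF sorted, of j i] that by (simp add: n_def)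
    then have "xs ! i = xs ! j"
      using sub finite_simplex[OF G mem[of j]] that by (metis card_seteq less_trans)
    then show False
      using xs(1) that by (simp add: nth_eq_iff_index_eq n_def)
  qed
  have carrier: "Z \<in> carrier_mat n n" "W \<in> carrier_mat n n"
    by (simp_all add: Z_def W_def)
  have "upper_triangular Z" "upper_triangular W"
    by (auto intro!: upper_triangularI simp: Z_def W_def no_sub)
  have det_Z: "det Z = 1"
    using det_upper_triangular[OF \<open>upper_triangular Z\<close> carrier(1)]
    by (simp add: prod_list_diag_prod Z_def)
  have det_W: "det W = (\<Prod>x\<in>simplices G. s x)"
  proof -
    have "det W = (\<Prod>i\<in>{0..<n}. s (xs ! i))"
      using det_upper_triangular[OF \<open>upper_triangular W\<close> carrier(2)]
      by (simp add: prod_list_diag_prod W_def)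
    also have "\<dots> = (\<Prod>x\<in>simplices G. s x)"
      using prod.reindex_bij_betw[OF bij_betw_nth[OF xs(1), of "{0..<n}" "simplices G"], of s]
        xs(2) by (simp add: n_def atLeast0LessThan)
    finally show ?thesis .
  qed
  have "1\<^sub>m n + adjacency_mat xs (connection_graph G) = Z\<^sup>T * W"
  proof (rule eq_matI)
    fix i j assume "i < dim_row (Z\<^sup>T * W)" "j < dim_col (Z\<^sup>T * W)"
    then have ij: "i < n" "j < n"
      by (simp_all add: Z_def W_def)
    let ?x = "xs ! i" and ?y = "xs ! j"
    have "(Z\<^sup>T * W) $$ (i, j) = (\<Sum>k = 0..<n. Z $$ (k, i) * W $$ (k, j))"
      using ij carrier by (simp add: scalar_prod_def)
    also have "\<dots> = (\<Sum>k = 0..<n. if xs ! k \<subseteq> ?x \<inter> ?y then s (xs ! k) else 0)"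
      using ij by (intro sum.cong) (auto simp: Z_def W_def)
    also have "\<dots> = sum_list (map (\<lambda>z. if z \<subseteq> ?x \<inter> ?y then s z else 0) xs)"
      by (simp add: sum_list_sum_nth n_def)
    also have "\<dots> = (\<Sum>z\<in>simplices G. if z \<subseteq> ?x \<inter> ?y then s z else 0)"
      by (simp only: sum.distinct_set_conv_list[OF xs(1)] flip: xs(2))
    also have "\<dots> = (\<Sum>z\<in>{z \<in> simplices G. z \<subseteq> ?x \<inter> ?y}. s z)"
      using finite_simplices[OF G] by (simp add: sum.inter_filter)
    \<comment> \<open>Simplices are closed under non-empty subsets, so every non-empty part of the
      intersection is itself a simplex.\<close>
    also have "{z \<in> simplices G. z \<subseteq> ?x \<inter> ?y} = {z. z \<noteq> {} \<and> z \<subseteq> ?x \<inter> ?y}"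
    proof (rule Collect_cong)
      show "z \<in> simplices G \<and> z \<subseteq> ?x \<inter> ?y \<longleftrightarrow> z \<noteq> {} \<and> z \<subseteq> ?x \<inter> ?y" for z
        using simplices_mono[OF mem[OF ij(1)], of z] simplices_nonempty[of z G] by auto
    qed
    also have "(\<Sum>z | z \<noteq> {} \<and> z \<subseteq> ?x \<inter> ?y. s z) = (if ?x \<inter> ?y = {} then 0 else 1)"
    proof (cases "?x \<inter> ?y = {}")
      case True
      then have "{z. z \<noteq> {} \<and> z \<subseteq> ?x \<inter> ?y} = {}"
        by auto
      then show ?thesis
        using True by (simp only: sum.empty if_True refl)
    next
      case False
      then show ?thesis
        using sum_simplex_sign_subsets[of "?x \<inter> ?y"] finite_simplex[OF G mem[OF ij(1)]]
        by (simp add: s_def)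
    qed
    \<comment> \<open>On the diagonal the identity matrix supplies the 1, in agreement with a
      simplex meeting itself because it is non-empty.\<close>
    also have "\<dots> = (1\<^sub>m n + adjacency_mat xs (connection_graph G)) $$ (i, j)"
      using ij mem[OF ij(1)] mem[OF ij(2)] xs(1)
      by (auto simp: adjacency_mat_def connection_graph_def n_def nth_eq_iff_index_eq simplices_def)
    finally show "(1\<^sub>m n + adjacency_mat xs (connection_graph G)) $$ (i, j) = (Z\<^sup>T * W) $$ (i, j)" ..
  qed (simp_all add: Z_def W_def adjacency_mat_def n_def)
  then have "fredholm_char G = det (Z\<^sup>T * W)"
    using fredholm_char_eq[OF xs] by (simp add: n_def)
  also have "\<dots> = (\<Prod>x\<in>simplices G. s x)"
    using carrier by (simp add: det_mult[of _ n] det_transpose[of _ n] det_Z det_W)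
  finally show ?thesis
    by (simp add: s_def)
qed

lemma fredholm_char_cases:
  assumes "pair_graph G"
  shows "fredholm_char G = 1 \<or> fredholm_char G = -1"
proof -
  \<comment> \<open>The induction also covers infinite \<open>A\<close>, where the product takes its
    default value 1.\<close>
  have "(\<Prod>x\<in>A. (-1) ^ simplex_dim x) = (1 :: real) \<or> (\<Prod>x\<in>A. (-1) ^ simplex_dim x) = (-1 :: real)"
    for A :: "'a set set"
    by (induction A rule: infinite_finite_induct) (auto simp: minus_one_power_iff)
  then show ?thesis
    by (simp add: fredholm_char_eq_prod[OF assms])
qed

text \<open>Modulo 2 every sign equals 1, so the alternating sum counts the simplices.\<close>

lemma even_euler_char_iff:
  assumes "pair_graph G"
  shows "even (euler_char G) \<longleftrightarrow> even (card (simplices G))"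
proof -
  have "even (\<Sum>x\<in>A. (-1) ^ simplex_dim x :: int) \<longleftrightarrow> even (card A)" if "finite A" for A :: "'a set set"
    using that by (induction A rule: finite_induct) (auto simp: minus_one_power_iff)
  then show ?thesis
    using finite_simplices[OF assms] by (simp add: euler_char_def)
qed

section \<open>Simplices of joins\<close>

lemma graph_join_simps [simp]:
  "pverts (graph_join G H) = pverts G <+> pverts H"
  "(Inl a, Inl b) \<in> parcs (graph_join G H) \<longleftrightarrow> (a, b) \<in> parcs G"
  "(Inr c, Inr d) \<in> parcs (graph_join G H) \<longleftrightarrow> (c, d) \<in> parcs H"
  "(Inl a, Inr c) \<in> parcs (graph_join G H) \<longleftrightarrow> a \<in> pverts G \<and> c \<in> pverts H"
  "(Inr c, Inl a) \<in> parcs (graph_join G H) \<longleftrightarrow> a \<in> pverts G \<and> c \<in> pverts H"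
  by (auto simp: graph_join_def)

text \<open>All cross edges are present, so a vertex set of the join is complete exactly when its
  two preimages are. The three families record which of the preimages, if any, is empty.\<close>

lemma simplices_join:
  "simplices (graph_join G H) = image Inl ` simplices G \<union> image Inr ` simplices H
    \<union> (\<lambda>(x, y). x <+> y) ` (simplices G \<times> simplices H)" (is "?L = ?R")
proof
  show "?L \<subseteq> ?R"
  proof
    fix z assume z: "z \<in> ?L"
    define x y where "x = Inl -` z" and "y = Inr -` z"
    have "u \<in> z \<longleftrightarrow> u \<in> x <+> y" for u
      by (cases u) (auto simp: x_def y_def)
    then have zxy: "z = x <+> y"
      by blast
    have "\<forall>u\<in>z. \<forall>v\<in>z. u \<noteq> v \<longrightarrow> (u, v) \<in> parcs (graph_join G H)" "z \<subseteq> pverts G <+> pverts H"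
      using z by (simp_all add: simplices_def)
    then have "x = {} \<or> x \<in> simplices G" "y = {} \<or> y \<in> simplices H"
      by (force simp: simplices_def x_def y_def)+
    moreover have "\<not> (x = {} \<and> y = {})"
      using z by (auto simp: zxy simplices_def)
    ultimately consider "x \<in> simplices G" "y = {}" | "x = {}" "y \<in> simplices H"
      | "x \<in> simplices G" "y \<in> simplices H"
      by blast
    then show "z \<in> ?R"
      by cases (auto simp: zxy Plus_def)
  qed
  have "image Inl ` simplices G \<subseteq> ?L" "image Inr ` simplices H \<subseteq> ?L"
    by (auto simp: simplices_def; blast)+
  moreover have join: "x <+> y \<in> ?L" if "x \<in> simplices G" "y \<in> simplices H" for x y
  proof -
    have x: "x \<noteq> {}" "x \<subseteq> pverts G" "\<And>u v. u \<in> x \<Longrightarrow> v \<in> x \<Longrightarrow> u \<noteq> v \<Longrightarrow> (u, v) \<in> parcs G"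
      and y: "y \<subseteq> pverts H" "\<And>u v. u \<in> y \<Longrightarrow> v \<in> y \<Longrightarrow> u \<noteq> v \<Longrightarrow> (u, v) \<in> parcs H"
      using that by (simp_all add: simplices_def)
    have arcs: "(u, v) \<in> parcs (graph_join G H)" if "u \<in> x <+> y" "v \<in> x <+> y" "u \<noteq> v" for u v
      using that x(2,3) y by (cases u; cases v) auto
    have "x <+> y \<noteq> {}" "x <+> y \<subseteq> pverts G <+> pverts H"
      using x(1,2) y(1) by auto
    then show ?thesis
      unfolding simplices_def graph_join_simps(1) by (intro CollectI conjI ballI impI arcs)
  qed
  ultimately show "?R \<subseteq> ?L"
    by (intro Un_least) (auto intro: join simp del: mem_Collect_eq)
qed

text \<open>These facts turn sums and products over the simplices of a join into ones over three
  separate families. The families stay apart because simplices are non-empty.\<close>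

lemma simplices_join_disjoint:
  fixes G :: "'a pair_pre_digraph" and H :: "'b pair_pre_digraph"
  shows "inj_on (image (Inl :: _ \<Rightarrow> 'a + 'b)) (simplices G)"
    "inj_on (image (Inr :: _ \<Rightarrow> 'a + 'b)) (simplices H)"
    "inj_on (\<lambda>(x, y). x <+> y) (simplices G \<times> simplices H)"
    "image Inl ` simplices G \<inter> (image Inr ` simplices H) = {}"
    "(image Inl ` simplices G \<union> image Inr ` simplices H)
      \<inter> (\<lambda>(x, y). x <+> y) ` (simplices G \<times> simplices H) = {}"
proof -
  have ne: "x \<noteq> {}" if "x \<in> simplices G" for x
    using that by (simp add: simplices_def)
  have ne': "x \<noteq> {}" if "x \<in> simplices H" for x
    using that by (simp add: simplices_def)
  show "inj_on (image (Inl :: _ \<Rightarrow> 'a + 'b)) (simplices G)"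
    "inj_on (image (Inr :: _ \<Rightarrow> 'a + 'b)) (simplices H)"
    by (auto simp: inj_on_def inj_image_eq_iff)
  show "inj_on (\<lambda>(x, y). x <+> y) (simplices G \<times> simplices H)"
    by (auto simp: inj_on_def Plus_def set_eq_iff)
  show "image Inl ` simplices G \<inter> (image Inr ` simplices H) = {}"
    using ne by fastforce
  show "(image Inl ` simplices G \<union> image Inr ` simplices H)
      \<inter> (\<lambda>(x, y). x <+> y) ` (simplices G \<times> simplices H) = {}"
    using ne ne' by (fastforce simp: Plus_def)
qed

text \<open>Equivalently, one plus the number of simplices is multiplicative under the join.\<close>

lemma card_simplices_join:
  fixes G :: "'a pair_pre_digraph" and H :: "'b pair_pre_digraph"
  assumes G: "pair_graph G" and H: "pair_graph H"
  shows "card (simplices (graph_join G H)) =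
    card (simplices G) + card (simplices H) + card (simplices G) * card (simplices H)"
proof -
  note fin = finite_simplices[OF G] finite_simplices[OF H]
  have "card (simplices (graph_join G H)) = card (image (Inl :: _ \<Rightarrow> 'a + 'b) ` simplices G)
      + card (image (Inr :: _ \<Rightarrow> 'a + 'b) ` simplices H) + card ((\<lambda>(x, y). x <+> y) ` (simplices G \<times> simplices H))"
    unfolding simplices_join
    using fin by (subst card_Un_disjoint; simp add: card_Un_disjoint simplices_join_disjoint(4,5))+
  then show ?thesis
    by (simp only: card_image card_cartesian_product simplices_join_disjoint(1-3))
qed

section \<open>The empty graph and multiplicativity on joins\<close>

lemma pair_graph_empty [simp]: "pair_graph empty_graph"
  by (simp add: pair_graph_iff empty_graph_def irrefl_def sym_def)

lemma simplices_empty [simp]: "simplices empty_graph = {}"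
  by (auto simp: simplices_def empty_graph_def)

lemma fredholm_char_empty [simp]: "fredholm_char empty_graph = 1"
  by (simp add: fredholm_char_eq_prod)

lemma euler_char_empty [simp]: "euler_char empty_graph = 0"
  by (simp add: euler_char_def)

lemma pair_graph_join:
  assumes "pair_graph G" "pair_graph H"
  shows "pair_graph (graph_join G H)"
  using assms by (auto simp: pair_graph_iff graph_join_def irrefl_def sym_def)

text \<open>All three terms of the simplex count of the join are even; this is the closure property
  of the sub-monoid.\<close>

lemma even_euler_char_join:
  assumes "pair_graph G" "pair_graph H" "even (euler_char G)" "even (euler_char H)"
  shows "even (euler_char (graph_join G H))"
  using assms by (simp add: even_euler_char_iff pair_graph_join card_simplices_join)

lemma fredholm_char_join:
  fixes G :: "'a pair_pre_digraph" and H :: "'b pair_pre_digraph"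
  assumes G: "pair_graph G" and H: "pair_graph H"
    and "even (euler_char G)" "even (euler_char H)"
  shows "fredholm_char (graph_join G H) = fredholm_char G * fredholm_char H"
proof -
  let ?s = "\<lambda>x. (-1 :: real) ^ simplex_dim x"
  have fin: "finite (simplices G)" "finite (simplices H)"
    by (simp_all add: finite_simplices G H)
  have even: "even (card (simplices G))" "even (card (simplices H))"
    using assms by (simp_all add: even_euler_char_iff)
  \<comment> \<open>The union has dimension dim x + dim y + 1, and the extra 1 produces the minus
    sign. Non-emptiness keeps the subtraction in \<open>simplex_dim\<close> from being
    truncated.\<close>
  have dim: "?s (x <+> y) = - (?s x * ?s y)" if "x \<in> simplices G" "y \<in> simplices H" for x y
  proof -
    have "finite x" "x \<noteq> {}" "finite y" "y \<noteq> {}"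
      using that finite_simplex[OF G] finite_simplex[OF H]
      by (auto simp: simplices_def)
    then have "simplex_dim (x <+> y) = Suc (simplex_dim x + simplex_dim y)"
      by (cases "card x"; cases "card y") (auto simp: simplex_dim_def card_Plus)
    then show ?thesis
      by (simp add: power_add)
  qed
  \<comment> \<open>Simplices from one factor keep their cardinality, so their signs multiply to the
    two Fredholm characteristics; the mixed simplices give the last factor.\<close>
  have "fredholm_char (graph_join G H) = fredholm_char G * fredholm_char H *
      (\<Prod>(x, y)\<in>simplices G \<times> simplices H. ?s (x <+> y))"
    using fin
    by (simp add: simplices_join_disjoint[unfolded case_prod_unfold] fredholm_char_eq_prod
        pair_graph_join G H simplices_join prod.union_disjoint prod.reindex case_prod_unfold
        simplex_dim_def card_image)
  also have "(\<Prod>(x, y)\<in>simplices G \<times> simplices H. ?s (x <+> y))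
      = (\<Prod>x\<in>simplices G. \<Prod>y\<in>simplices H. - (?s x * ?s y))"
    by (simp add: prod.cartesian_product[symmetric] dim)
  \<comment> \<open>For fixed \<open>x\<close>, the factors -1 and \<open>?s x\<close> each occur
    once per simplex of \<open>H\<close>, an even number of times, and cancel.\<close>
  also have "\<dots> = (\<Prod>x\<in>simplices G. \<Prod>y\<in>simplices H. ?s y)"
    using even(2) by (simp add: prod_uminus prod.distrib prod_constant power_mult[symmetric])
  \<comment> \<open>The inner product is \<open>fredholm_char H\<close>, a sign independent of
    \<open>x\<close>, raised to the even number of simplices of \<open>G\<close>.\<close>
  also have "\<dots> = 1"
    using even(1) fredholm_char_cases[OF H] by (auto simp flip: fredholm_char_eq_prod[OF H])
  finally show ?thesis
    by simp
qed

section \<open>Contractible graphs and spheres\<close>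

lemma graph_eqI:
  fixes G H :: "'a pair_pre_digraph"
  assumes "pverts G = pverts H" "\<And>u v. (u, v) \<in> parcs G \<longleftrightarrow> (u, v) \<in> parcs H"
  shows "G = H"
  using assms by (intro pair_pre_digraph.equality) auto

lemma unit_sphere_simps [simp]:
  "pverts (unit_sphere G x) = {y. (x, y) \<in> parcs G}"
  "(u, v) \<in> parcs (unit_sphere G x) \<longleftrightarrow> (u, v) \<in> parcs G \<and> (x, u) \<in> parcs G \<and> (x, v) \<in> parcs G"
  by (auto simp: unit_sphere_def pair_induce_def)

lemma remove_vertex_simps [simp]:
  "pverts (remove_vertex G x) = pverts G - {x}"
  "(u, v) \<in> parcs (remove_vertex G x) \<longleftrightarrow>
    (u, v) \<in> parcs G \<and> u \<in> pverts G - {x} \<and> v \<in> pverts G - {x}"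
  by (auto simp: remove_vertex_def pair_induce_def)

lemma pair_graph_pair_induce:
  assumes "pair_graph G" "S \<subseteq> pverts G"
  shows "pair_graph (pair_induce G S)"
  using assms by (auto simp: pair_graph_iff pair_induce_def irrefl_def sym_def intro: finite_subset)

lemma pair_graph_unit_sphere: "pair_graph G \<Longrightarrow> pair_graph (unit_sphere G x)"
  unfolding unit_sphere_def by (rule pair_graph_pair_induce) (auto dest: pair_graphD)

lemma pair_graph_remove_vertex: "pair_graph G \<Longrightarrow> pair_graph (remove_vertex G x)"
  unfolding remove_vertex_def by (rule pair_graph_pair_induce) auto

text \<open>Simplices are split by whether they contain \<open>x\<close>. Those that do are cones
  with apex \<open>x\<close> over simplices of the unit sphere, and the added empty set accounts for
  \<open>{x}\<close>.\<close>

lemma simplices_delete: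
  assumes G: "pair_graph G" and x: "x \<in> pverts G"
  shows "simplices G =
    simplices (remove_vertex G x) \<union> insert x ` insert {} (simplices (unit_sphere G x))" (is "_ = ?R")
proof
  show "simplices G \<subseteq> ?R"
  proof
    fix z assume z: "z \<in> simplices G"
    show "z \<in> ?R"
    proof (cases "x \<in> z")
      case False
      with z have "z \<in> simplices (remove_vertex G x)"
        by (auto simp: simplices_def)
      then show ?thesis ..
    next
      case True
      with z have "z - {x} \<in> insert {} (simplices (unit_sphere G x))"
        by (auto simp: simplices_def)
      then show ?thesis
        using True by (metis UnI2 imageI insert_Diff)
    qed
  qed
  have "simplices (remove_vertex G x) \<subseteq> simplices G"
    by (auto simp: simplices_def)
  moreover have "insert x y \<in> simplices G" if "y \<in> insert {} (simplices (unit_sphere G x))" for y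
    using that x by (auto simp: simplices_def dest: pair_graphD(2)[OF G] intro: pair_graphD(3)[OF G])
  ultimately show "?R \<subseteq> simplices G"
    by (intro Un_least image_subsetI)
qed

lemma card_simplices_delete:
  assumes G: "pair_graph G" and x: "x \<in> pverts G"
  shows "card (simplices G) =
    card (simplices (remove_vertex G x)) + Suc (card (simplices (unit_sphere G x)))"
proof -
  let ?S = "insert {} (simplices (unit_sphere G x))"
  have fin: "finite (simplices (remove_vertex G x))" "finite (simplices (unit_sphere G x))"
    by (simp_all add: finite_simplices pair_graph_remove_vertex pair_graph_unit_sphere G)
  \<comment> \<open>Loop-freeness keeps \<open>x\<close> out of its own unit sphere, so inserting
    \<open>x\<close> is injective on these sets.\<close>
  have notin: "x \<notin> y" if "y \<in> ?S" for y
    using that pair_graphD(4)[OF G] by (auto simp: simplices_def)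
  have inj: "inj_on (insert x) ?S"
    using notin by (intro inj_onI) (metis insert_ident)
  have "{} \<notin> simplices (unit_sphere G x)"
    by (simp add: simplices_def)
  then have "card (insert x ` ?S) = Suc (card (simplices (unit_sphere G x)))"
    unfolding card_image[OF inj] using fin by simp
  moreover have "simplices (remove_vertex G x) \<inter> insert x ` ?S = {}"
    by (auto simp: simplices_def)
  ultimately show ?thesis
    using fin by (subst simplices_delete[OF assms], subst card_Un_disjoint) auto
qed

text \<open>A single vertex has one simplex; in the inductive step the count is odd + 1 +
  odd.\<close>

lemma contractible_odd_simplices: "graph_contractible G \<Longrightarrow> odd (card (simplices G))"
proof (induction rule: graph_contractible.induct)
  case (K1 G)
  then obtain v where v: "pverts G = {v}"
    by (auto simp: card_1_singleton_iff)
  have "simplices G = {{v}}"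
    using v by (auto simp: simplices_def)
  then show ?case
    by simp
next
  case (step G x)
  then show ?case
    by (simp add: card_simplices_delete)
qed

lemma dim_sphere_pair_graph: "dim_sphere d G \<Longrightarrow> pair_graph G"
  by (induction rule: dim_sphere.induct) auto

text \<open>The empty sphere has no simplices. Otherwise delete a vertex whose removal leaves a
  contractible graph: the count is odd + 1 + even, the last by induction on its unit sphere.\<close>

lemma dim_sphere_even_simplices: "dim_sphere d G \<Longrightarrow> even (card (simplices G))"
proof (induction rule: dim_sphere.induct)
  case empty
  then show ?case
    by simp
next
  case (step d G)
  then obtain x where "x \<in> pverts G" "graph_contractible (remove_vertex G x)"
    by auto
  with step show ?case
    by (simp add: card_simplices_delete contractible_odd_simplices)
qed

lemma graph_sphere_pair_graph: "graph_sphere G \<Longrightarrow> pair_graph G"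
  by (auto simp: graph_sphere_def dim_sphere_pair_graph)

lemma graph_sphere_even_euler_char: "graph_sphere G \<Longrightarrow> even (euler_char G)"
  using dim_sphere_even_simplices by (auto simp: graph_sphere_def even_euler_char_iff dim_sphere_pair_graph)

lemma graph_sphere_empty: "graph_sphere empty_graph"
  using dim_sphere.empty by (auto simp: graph_sphere_def)

lemma graph_sphere_fredholm_join:
  assumes "graph_sphere G" "graph_sphere H"
  shows "fredholm_char (graph_join G H) = fredholm_char G * fredholm_char H"
  using assms by (intro fredholm_char_join graph_sphere_pair_graph graph_sphere_even_euler_char)

section \<open>Isomorphic copies\<close>

text \<open>Isomorphic copies, possibly over another vertex type, are images under an
  \<open>f\<close> that is injective on the vertices. Isomorphisms are handled in this form
  throughout.\<close>

definition map_graph :: "('a \<Rightarrow> 'b) \<Rightarrow> 'a pair_pre_digraph \<Rightarrow> 'b pair_pre_digraph" where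
  "map_graph f G = \<lparr>pverts = f ` pverts G, parcs = map_prod f f ` parcs G\<rparr>"

lemma pverts_map_graph [simp]: "pverts (map_graph f G) = f ` pverts G"
  by (simp add: map_graph_def)

lemma in_parcs_map_graph:
  "(u, v) \<in> parcs (map_graph f G) \<longleftrightarrow> (\<exists>a b. u = f a \<and> v = f b \<and> (a, b) \<in> parcs G)"
  by (force simp: map_graph_def)

lemma parcs_map_graph_iff:
  assumes "pair_graph G" "inj_on f (pverts G)" "a \<in> pverts G" "b \<in> pverts G"
  shows "(f a, f b) \<in> parcs (map_graph f G) \<longleftrightarrow> (a, b) \<in> parcs G"
  using assms pair_graphD(2)[OF assms(1)] by (auto simp: in_parcs_map_graph dest: inj_onD)

lemma pair_graph_map_graph:
  assumes "pair_graph G" "inj_on f (pverts G)"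
  shows "pair_graph (map_graph f G)"
proof -
  have "irrefl (parcs (map_graph f G))"
    using pair_graphD[OF assms(1)] assms(2)
    by (auto simp: irrefl_def in_parcs_map_graph) (metis inj_onD)
  moreover have "sym (parcs (map_graph f G))"
    by (auto simp: sym_def in_parcs_map_graph intro: pair_graphD(3)[OF assms(1)])
  moreover have "parcs (map_graph f G) \<subseteq> f ` pverts G \<times> f ` pverts G"
    using pair_graphD(2)[OF assms(1)] by (auto simp: in_parcs_map_graph)
  ultimately show ?thesis
    using pair_graphD(1)[OF assms(1)] by (simp add: pair_graph_iff)
qed

lemma map_graph_comp: "map_graph g (map_graph f G) = map_graph (g \<circ> f) G"
  by (simp add: map_graph_def image_comp prod.map_comp)

lemma map_graph_cong:
  assumes "pair_graph G" "\<And>x. x \<in> pverts G \<Longrightarrow> f x = g x"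
  shows "map_graph f G = map_graph g G"
  using assms(2) pair_graphD(2)[OF assms(1)] by (auto simp: map_graph_def intro!: image_cong)

lemma unit_sphere_map_graph:
  assumes "pair_graph G" "inj_on f (pverts G)" "x \<in> pverts G"
  shows "unit_sphere (map_graph f G) (f x) = map_graph f (unit_sphere G x)"
proof -
  have eq: "(f x, f a) \<in> parcs (map_graph f G) \<longleftrightarrow> (x, a) \<in> parcs G" if "a \<in> pverts G" for a
    using parcs_map_graph_iff assms that by metis
  have "\<exists>a. a \<in> pverts G \<and> v = f a" if "(u, v) \<in> parcs (map_graph f G)" for u v
    using that pair_graphD(2)[OF assms(1)] by (auto simp: in_parcs_map_graph)
  then have verts: "{v. (f x, v) \<in> parcs (map_graph f G)} = f ` {a. (x, a) \<in> parcs G}"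
    using eq pair_graphD(2)[OF assms(1)] by blast
  show ?thesis
  proof (rule graph_eqI)
    show "(u, v) \<in> parcs (unit_sphere (map_graph f G) (f x)) \<longleftrightarrow>
        (u, v) \<in> parcs (map_graph f (unit_sphere G x))" for u v
      using eq pair_graphD(2)[OF assms(1)] by (simp add: in_parcs_map_graph[of u v]) metis
  qed (simp add: verts)
qed

lemma remove_vertex_map_graph:
  assumes "pair_graph G" "inj_on f (pverts G)" "x \<in> pverts G"
  shows "remove_vertex (map_graph f G) (f x) = map_graph f (remove_vertex G x)"
proof (rule graph_eqI)
  show "(u, v) \<in> parcs (remove_vertex (map_graph f G) (f x)) \<longleftrightarrow>
      (u, v) \<in> parcs (map_graph f (remove_vertex G x))" for u v
    using assms(2,3) pair_graphD(2)[OF assms(1)]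
    by (simp add: in_parcs_map_graph[of u v]) (metis imageI inj_onD)
  show "pverts (remove_vertex (map_graph f G) (f x)) = pverts (map_graph f (remove_vertex G x))"
    using assms(2,3) by (auto dest: inj_onD)
qed

text \<open>Unit sphere and deletion at a copied vertex are copies of the originals, and
  \<open>f\<close> stays injective on them, so the inductive construction transfers step by
  step.\<close>

lemma contractible_map_graph:
  "graph_contractible G \<Longrightarrow> inj_on f (pverts G) \<Longrightarrow> graph_contractible (map_graph f G)"
proof (induction rule: graph_contractible.induct)
  case (K1 G)
  then show ?case
    by (intro graph_contractible.K1) (simp_all add: pair_graph_map_graph card_image)
next
  case (step G x)
  have "pverts (unit_sphere G x) \<subseteq> pverts G" "pverts (remove_vertex G x) \<subseteq> pverts G"
    using pair_graphD(2)[OF step.hyps(1)] by auto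
  then have "graph_contractible (unit_sphere (map_graph f G) (f x))"
      "graph_contractible (remove_vertex (map_graph f G) (f x))"
    using step inj_on_subset[OF step.prems]
    by (simp_all add: unit_sphere_map_graph remove_vertex_map_graph)
  then show ?case
    using step by (auto intro!: graph_contractible.step[of "map_graph f G" "f x"] pair_graph_map_graph)
qed

text \<open>The same transfer as for contractibility. It allows a sphere on a sum type to be
  replaced by a copy on \<open>nat\<close>.\<close>

lemma dim_sphere_map_graph:
  "dim_sphere d G \<Longrightarrow> inj_on f (pverts G) \<Longrightarrow> dim_sphere d (map_graph f G)"
proof (induction rule: dim_sphere.induct)
  case empty
  have "map_graph f empty_graph = empty_graph"
    by (simp add: map_graph_def empty_graph_def)
  then show ?case
    by (simp add: dim_sphere.empty)
next
  case (step d G)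
  have inj: "inj_on f (pverts (unit_sphere G x))" "inj_on f (pverts (remove_vertex G x))" for x
    using pair_graphD(2)[OF step.hyps(2)] by (auto intro!: inj_on_subset[OF step.prems])
  show ?case
  proof (rule dim_sphere.step)
    show "0 \<le> d" "pair_graph (map_graph f G)"
      using step by (simp_all add: pair_graph_map_graph)
    show "dim_sphere (d - 1) (unit_sphere (map_graph f G) y)" if "y \<in> pverts (map_graph f G)" for y
      using that step.IH inj(1) by (auto simp: unit_sphere_map_graph step)
    obtain x where "x \<in> pverts G" "graph_contractible (remove_vertex G x)"
      using step.hyps by blast
    then have "f x \<in> pverts (map_graph f G)" "graph_contractible (remove_vertex (map_graph f G) (f x))"
      using inj(2)[of x] by (simp_all add: remove_vertex_map_graph step contractible_map_graph)
    then show "\<exists>y\<in>pverts (map_graph f G). graph_contractible (remove_vertex (map_graph f G) y)"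
      by blast
  qed
qed

section \<open>Invariance of simplices and of the Fredholm characteristic\<close>

lemma simplices_map_graph:
  assumes "pair_graph G" "inj_on f (pverts G)"
  shows "simplices (map_graph f G) = image f ` simplices G"
proof
  show "simplices (map_graph f G) \<subseteq> image f ` simplices G"
  proof
    fix z assume z: "z \<in> simplices (map_graph f G)"
    then have "z \<subseteq> f ` pverts G" by (simp add: simplices_def)
    then obtain y where y: "y \<subseteq> pverts G" "z = f ` y"
      by (auto simp: subset_image_iff)
    have "(u, v) \<in> parcs G" if "u \<in> y" "v \<in> y" "u \<noteq> v" for u v
    proof -
      \<comment> \<open>Completeness of \<open>z\<close> yields arcs between distinct vertices only,
        so the images have to be kept apart first.\<close>
      have "f u \<noteq> f v"
        using that y assms(2) by (meson inj_onD subsetD)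
      then have "(f u, f v) \<in> parcs (map_graph f G)"
        using z that by (auto simp: y simplices_def)
      then show ?thesis
        using parcs_map_graph_iff[OF assms] that y(1) by blast
    qed
    then have "y \<in> simplices G"
      using y z by (auto simp: simplices_def)
    then show "z \<in> image f ` simplices G"
      using y(2) by blast
  qed
  show "image f ` simplices G \<subseteq> simplices (map_graph f G)"
    by (auto simp: simplices_def in_parcs_map_graph) metis
qed

text \<open>The product formula replaces the determinant: simplices correspond under
  \<open>f\<close> and keep their cardinality, hence their sign.\<close>

lemma fredholm_char_map_graph:
  assumes "pair_graph G" "inj_on f (pverts G)"
  shows "fredholm_char (map_graph f G) = fredholm_char G"
proof -
  have sub: "x \<subseteq> pverts G" if "x \<in> simplices G" for x
    using that by (simp add: simplices_def)
  have "inj_on (image f) (simplices G)"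
    using sub by (intro inj_onI) (metis inj_on_image_eq_iff assms(2))
  moreover have "simplex_dim (f ` x) = simplex_dim x" if "x \<in> simplices G" for x
    using inj_on_subset[OF assms(2) sub[OF that]] by (simp add: simplex_dim_def card_image)
  ultimately show ?thesis
    by (simp add: fredholm_char_eq_prod assms pair_graph_map_graph simplices_map_graph prod.reindex)
qed

section \<open>Joins of spheres\<close>

text \<open>A vertex of one factor is adjacent to the whole other factor, which therefore lies in
  its unit sphere together with all the cross edges.\<close>

lemma unit_sphere_join:
  assumes "pair_graph G" "pair_graph H"
  shows "x \<in> pverts G \<Longrightarrow> unit_sphere (graph_join G H) (Inl x) = graph_join (unit_sphere G x) H"
    and "y \<in> pverts H \<Longrightarrow> unit_sphere (graph_join G H) (Inr y) = graph_join G (unit_sphere H y)"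
proof -
  note D = pair_graphD(2)[OF assms(1)] pair_graphD(2)[OF assms(2)]
  show "unit_sphere (graph_join G H) (Inl x) = graph_join (unit_sphere G x) H" if "x \<in> pverts G"
  proof (rule graph_eqI)
    have "u \<in> pverts (unit_sphere (graph_join G H) (Inl x)) \<longleftrightarrow>
        u \<in> pverts (graph_join (unit_sphere G x) H)" for u
      using that by (cases u) auto
    then show "pverts (unit_sphere (graph_join G H) (Inl x)) = pverts (graph_join (unit_sphere G x) H)"
      by blast
    show "(u, v) \<in> parcs (unit_sphere (graph_join G H) (Inl x)) \<longleftrightarrow>
        (u, v) \<in> parcs (graph_join (unit_sphere G x) H)" for u v
      using that D by (cases u; cases v) auto
  qed
  show "unit_sphere (graph_join G H) (Inr y) = graph_join G (unit_sphere H y)" if "y \<in> pverts H"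
  proof (rule graph_eqI)
    have "u \<in> pverts (unit_sphere (graph_join G H) (Inr y)) \<longleftrightarrow>
        u \<in> pverts (graph_join G (unit_sphere H y))" for u
      using that by (cases u) auto
    then show "pverts (unit_sphere (graph_join G H) (Inr y)) = pverts (graph_join G (unit_sphere H y))"
      by blast
    show "(u, v) \<in> parcs (unit_sphere (graph_join G H) (Inr y)) \<longleftrightarrow>
        (u, v) \<in> parcs (graph_join G (unit_sphere H y))" for u v
      using that D by (cases u; cases v) auto
  qed
qed

lemma remove_vertex_join:
  assumes "pair_graph G" "pair_graph H"
  shows "remove_vertex (graph_join G H) (Inl x) = graph_join (remove_vertex G x) H"
    and "remove_vertex (graph_join G H) (Inr y) = graph_join G (remove_vertex H y)"
proof -
  note D = pair_graphD(2)[OF assms(1)] pair_graphD(2)[OF assms(2)]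
  show "remove_vertex (graph_join G H) (Inl x) = graph_join (remove_vertex G x) H"
  proof (rule graph_eqI)
    show "(u, v) \<in> parcs (remove_vertex (graph_join G H) (Inl x)) \<longleftrightarrow>
        (u, v) \<in> parcs (graph_join (remove_vertex G x) H)" for u v
      using D by (cases u; cases v) auto
  qed auto
  show "remove_vertex (graph_join G H) (Inr y) = graph_join G (remove_vertex H y)"
  proof (rule graph_eqI)
    show "(u, v) \<in> parcs (remove_vertex (graph_join G H) (Inr y)) \<longleftrightarrow>
        (u, v) \<in> parcs (graph_join G (remove_vertex H y))" for u v
      using D by (cases u; cases v) auto
  qed auto
qed

text \<open>The join is a cone over \<open>H\<close>. At a vertex of \<open>H\<close>, both its unit
  sphere and its complement in the cone are cones over graphs with fewer vertices; the cone over the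
  empty graph is a single vertex.\<close>

lemma contractible_join_K1:
  assumes G: "pair_graph G" "card (pverts G) = 1"
  shows "pair_graph H \<Longrightarrow> graph_contractible (graph_join G H)"
proof (induction "card (pverts H)" arbitrary: H rule: less_induct)
  case less
  have finG: "finite (pverts G)" and finH: "finite (pverts H)"
    using G(1) less.prems by (simp_all add: pair_graphD)
  show ?case
  proof (cases "pverts H = {}")
    case True
    then show ?thesis
      using G less.prems finG
      by (intro graph_contractible.K1) (simp_all add: pair_graph_join card_Plus)
  next
    case False
    then obtain y where y: "y \<in> pverts H"
      by blast
    have "pverts (unit_sphere H y) \<subset> pverts H" "pverts (remove_vertex H y) \<subset> pverts H"
      using y pair_graphD(2,4)[OF less.prems] by auto
    then have "graph_contractible (graph_join G (unit_sphere H y))"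
        "graph_contractible (graph_join G (remove_vertex H y))"
      using less by (auto intro!: less.hyps psubset_card_mono[OF finH]
          pair_graph_unit_sphere pair_graph_remove_vertex simp del: unit_sphere_simps remove_vertex_simps)
    then show ?thesis
      using y G(1) less.prems
      by - (rule graph_contractible.step[of _ "Inr y"],
        simp_all add: pair_graph_join unit_sphere_join remove_vertex_join InrI)
  qed
qed

text \<open>The vertices of \<open>G\<close> are removed in the order of its own contraction, with
  \<open>H\<close> joined on at every stage, until a cone over \<open>H\<close> is left.\<close>

lemma contractible_join:
  "graph_contractible G \<Longrightarrow> pair_graph H \<Longrightarrow> graph_contractible (graph_join G H)"
proof (induction rule: graph_contractible.induct)
  case (K1 G)
  then show ?case
    by (rule contractible_join_K1)
next
  case (step G x)
  then show ?case
    by - (rule graph_contractible.step[of _ "Inl x"],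
      simp_all add: pair_graph_join unit_sphere_join remove_vertex_join InlI)
qed

text \<open>The join lives on a sum type, so the empty graph is neutral only up to
  relabelling.\<close>

lemma graph_join_empty:
  "graph_join G empty_graph = map_graph Inl G"
  "graph_join empty_graph G = map_graph Inr G"
  by (simp_all add: graph_join_def map_graph_def empty_graph_def Plus_def)

text \<open>The shift by 1 makes the empty sphere, of dimension -1, neutral. Unit spheres of the
  join are joins in which one factor is replaced by a unit sphere of dimension one less, so two
  nested inductions apply.\<close>

lemma dim_sphere_join:
  "dim_sphere d G \<Longrightarrow> dim_sphere e H \<Longrightarrow> dim_sphere (d + e + 1) (graph_join G H)"
proof (induction arbitrary: e H rule: dim_sphere.induct)
  case empty
  then show ?case
    using dim_sphere_map_graph[of e H Inr] by (simp add: graph_join_empty)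
next
  case G: (step d G)
  \<comment> \<open>The inner induction runs over \<open>H\<close> with \<open>G\<close> fixed. A
    vertex of \<open>G\<close> uses the outer hypothesis, a vertex of \<open>H\<close> the inner
    one.\<close>
  from G.prems show ?case
  proof (induction rule: dim_sphere.induct)
    case empty
    have "dim_sphere d G"
      by (rule dim_sphere.step[OF G.hyps])
    then show ?case
      using dim_sphere_map_graph[of d G Inl] by (simp add: graph_join_empty)
  next
    case H: (step e H)
    have sphere_H: "dim_sphere e H"
      by (rule dim_sphere.step[OF H.hyps])
    show ?case
    proof (rule dim_sphere.step)
      show "0 \<le> d + e + 1" "pair_graph (graph_join G H)"
        using G.hyps H.hyps by (simp_all add: pair_graph_join)
      show "dim_sphere (d + e + 1 - 1) (unit_sphere (graph_join G H) z)"
        if "z \<in> pverts (graph_join G H)" for z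
      proof (cases z)
        case (Inl x)
        with that G.IH[of x e H] sphere_H show ?thesis
          by (auto simp: unit_sphere_join G.hyps H.hyps)
      next
        case (Inr y)
        with that H.IH[of y] show ?thesis
          by (auto simp: unit_sphere_join G.hyps H.hyps algebra_simps)
      qed
      \<comment> \<open>A vertex of \<open>G\<close> suffices: what is left is the join of a
        contractible graph with \<open>H\<close>.\<close>
      obtain x where "x \<in> pverts G" "graph_contractible (remove_vertex G x)"
        using G.hyps by blast
      then have "Inl x \<in> pverts (graph_join G H)"
          "graph_contractible (remove_vertex (graph_join G H) (Inl x))"
        using G.hyps H.hyps by (simp_all add: remove_vertex_join contractible_join InlI)
      then show "\<exists>z\<in>pverts (graph_join G H). graph_contractible (remove_vertex (graph_join G H) z)"
        by blast
    qed
  qed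
qed

lemma graph_sphere_join: "graph_sphere G \<Longrightarrow> graph_sphere H \<Longrightarrow> graph_sphere (graph_join G H)"
  using dim_sphere_join unfolding graph_sphere_def by blast

lemma graph_sphere_map_graph: "graph_sphere G \<Longrightarrow> inj_on f (pverts G) \<Longrightarrow> graph_sphere (map_graph f G)"
  using dim_sphere_map_graph unfolding graph_sphere_def by blast

section \<open>Isomorphism classes\<close>

text \<open>The digraph isomorphisms also carry maps for arcs, tails and heads. As tails and heads
  are projections on both sides, the arc map is determined by the vertex map.\<close>

lemma digraph_iso_iff:
  fixes G :: "'a pair_pre_digraph" and H :: "'b pair_pre_digraph"
  assumes G: "pair_graph G"
  shows "digraph_iso (with_proj G) (with_proj H) \<longleftrightarrow> (\<exists>f. inj_on f (pverts G) \<and> H = map_graph f G)"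
proof
  assume "digraph_iso (with_proj G) (with_proj H)"
  then obtain h where h: "pre_digraph.digraph_isomorphism (with_proj G) h"
    and H: "with_proj H = app_iso h (with_proj G)"
    by (auto simp: digraph_iso_def)
  note iso = h[unfolded pre_digraph.digraph_isomorphism_def, simplified]
  have eqs: "pverts H = iso_verts h ` pverts G" "parcs H = iso_arcs h ` parcs G"
    "iso_tail h = fst" "iso_head h = snd"
    using H by (simp_all add: with_proj_def app_iso_def)
  \<comment> \<open>An arc of \<open>H\<close> is the pair of its tail and head, and these are the
    images of the tail and head of \<open>a\<close>.\<close>
  have "iso_arcs h a = map_prod (iso_verts h) (iso_verts h) a" if "a \<in> parcs G" for a
    using that iso eqs(3,4) by (intro prod_eqI) auto
  then have "H = map_graph (iso_verts h) G"
    using eqs(1,2) by (intro pair_pre_digraph.equality) (auto simp: map_graph_def intro!: image_cong)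
  then show "\<exists>f. inj_on f (pverts G) \<and> H = map_graph f G"
    using iso by blast
next
  assume "\<exists>f. inj_on f (pverts G) \<and> H = map_graph f G"
  then obtain f where f: "inj_on f (pverts G)" and H: "H = map_graph f G"
    by blast
  interpret pair_graph G
    by (rule G)
  let ?h = "\<lparr>iso_verts = f, iso_arcs = map_prod f f, iso_head = snd, iso_tail = fst\<rparr>"
  have "inj_on (map_prod f f) (parcs G)"
    by (rule inj_on_subset[OF map_prod_inj_on[OF f f]]) (auto dest: in_arcsD1 in_arcsD2)
  then have "pre_digraph.digraph_isomorphism (with_proj G) ?h"
    using f wf_digraph by (simp add: pre_digraph.digraph_isomorphism_def)
  moreover have "with_proj H = app_iso ?h (with_proj G)"
    by (simp add: H map_graph_def app_iso_def with_proj_def)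
  ultimately show "digraph_iso (with_proj G) (with_proj H)"
    unfolding digraph_iso_def by blast
qed

lemma iso_class_eq:
  "pair_graph G \<Longrightarrow> iso_class G = {map_graph f G | f. inj_on f (pverts G)}"
  by (auto simp: iso_class_def digraph_iso_iff)

lemma iso_class_map_graph:
  assumes G: "pair_graph G" and f: "inj_on f (pverts G)"
  shows "iso_class (map_graph f G) = iso_class G"
proof -
  have mG: "pair_graph (map_graph f G)"
    using assms by (rule pair_graph_map_graph)
  show ?thesis
  proof
    show "iso_class (map_graph f G) \<subseteq> iso_class G"
      using f by (auto simp: iso_class_eq G mG map_graph_comp intro: comp_inj_on)
    show "iso_class G \<subseteq> iso_class (map_graph f G)"
    proof
      fix H assume "H \<in> iso_class G"
      then obtain g where g: "inj_on g (pverts G)" "H = map_graph g G"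
        by (auto simp: iso_class_eq G)
      \<comment> \<open>A copy of \<open>G\<close> is reached from the relabelled graph by first
        undoing \<open>f\<close>.\<close>
      let ?g = "g \<circ> the_inv_into (pverts G) f"
      have "inj_on ?g (pverts (map_graph f G))"
        using f g(1) by (auto intro!: comp_inj_on inj_on_the_inv_into simp: the_inv_into_onto)
      moreover have "H = map_graph ?g (map_graph f G)"
        unfolding g(2) map_graph_comp using f
        by (intro map_graph_cong[OF G]) (simp add: the_inv_into_f_f)
      ultimately show "H \<in> iso_class (map_graph f G)"
        unfolding iso_class_eq[OF mG] by blast
    qed
  qed
qed

lemma nat_copy:
  assumes "pair_graph G"
  obtains f :: "'a \<Rightarrow> nat" where "inj_on f (pverts G)"
  using finite_imp_inj_to_nat_seg[OF pair_graphD(1)[OF assms]] by blast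

text \<open>A finite graph always has a copy on \<open>nat\<close>, so its class can serve to
  recover isomorphism invariants.\<close>

lemma iso_class_nonempty: "pair_graph G \<Longrightarrow> iso_class G \<noteq> {}"
  using nat_copy[of G] by (auto simp: iso_class_eq)

text \<open>Any common member \<open>K\<close> of the classes is a copy of both graphs, whose vertex
  types may differ.\<close>

lemma fredholm_char_iso_class:
  assumes "pair_graph G" "pair_graph H" "iso_class G = iso_class H"
  shows "fredholm_char G = fredholm_char H"
proof -
  obtain K where K: "K \<in> iso_class G"
    using iso_class_nonempty[OF assms(1)] by blast
  have "fredholm_char K = fredholm_char G"
    using K assms(1) by (auto simp: iso_class_eq fredholm_char_map_graph)
  moreover have "fredholm_char K = fredholm_char H"
    using K[unfolded assms(3)] assms(2) by (auto simp: iso_class_eq fredholm_char_map_graph)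
  ultimately show ?thesis
    by simp
qed

lemma sphere_nat_copy:
  fixes G :: "'a pair_pre_digraph"
  assumes G: "graph_sphere G"
  obtains G' :: "nat pair_pre_digraph" where "graph_sphere G'" "iso_class G' = iso_class G"
    "fredholm_char G' = fredholm_char G"
proof -
  have pG: "pair_graph G"
    using G by (rule graph_sphere_pair_graph)
  obtain f :: "'a \<Rightarrow> nat" where "inj_on f (pverts G)"
    using nat_copy[OF pG] .
  with that[of "map_graph f G"] show thesis
    by (simp add: graph_sphere_map_graph iso_class_map_graph fredholm_char_map_graph pG G)
qed

section \<open>The monoid of spheres\<close>

lemma graph_join_map_graph:
  "graph_join (map_graph f G) (map_graph g H) = map_graph (map_sum f g) (graph_join G H)"
proof (rule graph_eqI)
  show "(u, v) \<in> parcs (graph_join (map_graph f G) (map_graph g H)) \<longleftrightarrow>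
      (u, v) \<in> parcs (map_graph (map_sum f g) (graph_join G H))" for u v
    by (cases u; cases v) (auto simp: in_parcs_map_graph split_sum_ex)
qed (auto simp: Plus_def image_Un image_image)

lemma graph_join_commute: "graph_join H G = map_graph (case_sum Inr Inl) (graph_join G H)"
proof (rule graph_eqI)
  show "(u, v) \<in> parcs (graph_join H G) \<longleftrightarrow>
      (u, v) \<in> parcs (map_graph (case_sum Inr Inl) (graph_join G H))" for u v
    by (cases u; cases v) (auto simp: in_parcs_map_graph split_sum_ex)
qed (auto simp: Plus_def image_Un image_image)

lemma graph_join_assoc:
  "graph_join G (graph_join H K) =
    map_graph (case_sum (case_sum Inl (Inr \<circ> Inl)) (Inr \<circ> Inr)) (graph_join (graph_join G H) K)"
  (is "_ = map_graph ?f _")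
proof (rule graph_eqI)
  have "\<forall>u v. (u, v) \<in> parcs (graph_join G (graph_join H K)) \<longleftrightarrow>
      (u, v) \<in> parcs (map_graph ?f (graph_join (graph_join G H) K))"
    by (auto simp: split_sum_all in_parcs_map_graph split_sum_ex)
  then show "(u, v) \<in> parcs (graph_join G (graph_join H K)) \<longleftrightarrow>
      (u, v) \<in> parcs (map_graph ?f (graph_join (graph_join G H) K))" for u v
    by blast
qed (auto simp: Plus_def image_Un image_image)

text \<open>The product of classes is a union over all representatives. The class of the join does
  not depend on them, so the union is over a constant family, and non-emptiness makes it equal to
  that class.\<close>

lemma sphere_mult:
  assumes G: "pair_graph G" and H: "pair_graph H"
  shows "iso_class G \<otimes>\<^bsub>sphere_monoid\<^esub> iso_class H = iso_class (graph_join G H)"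
proof -
  have eq: "iso_class (graph_join G' H') = iso_class (graph_join G H)"
    if G': "G' \<in> iso_class G" and H': "H' \<in> iso_class H" for G' H'
  proof -
    obtain f g where f: "inj_on f (pverts G)" "G' = map_graph f G"
      and g: "inj_on g (pverts H)" "H' = map_graph g H"
      using G' H' by (auto simp: iso_class_eq G H)
    have "inj_on (map_sum f g) (pverts (graph_join G H))"
      by (auto intro!: inj_onI dest: inj_onD[OF f(1)] inj_onD[OF g(1)])
    then show ?thesis
      by (simp add: f(2) g(2) graph_join_map_graph iso_class_map_graph pair_graph_join G H)
  qed
  have "(\<Union>G'\<in>iso_class G. \<Union>H'\<in>iso_class H. iso_class (graph_join G' H')) =
      (\<Union>G'\<in>iso_class G. \<Union>H'\<in>iso_class H. iso_class (graph_join G H))"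
    by (rule SUP_cong[OF refl], rule SUP_cong[OF refl], rule eq)
  then show ?thesis
    using iso_class_nonempty[OF G] iso_class_nonempty[OF H] by (simp add: sphere_monoid_def)
qed

lemma iso_class_in_sphere_monoid: "graph_sphere G \<Longrightarrow> iso_class G \<in> carrier sphere_monoid"
proof -
  assume "graph_sphere G"
  then obtain G' :: "nat pair_pre_digraph" where "graph_sphere G'" "iso_class G' = iso_class G"
    by (rule sphere_nat_copy)
  then show ?thesis
    by (auto simp: sphere_monoid_def image_iff)
qed

text \<open>Each law holds for graphs up to a relabelling of sum types, and \<open>iso_class\<close>
  absorbs relabellings.\<close>

lemma comm_monoid_sphere_monoid: "comm_monoid sphere_monoid"
proof -
  have carrier: "\<exists>G :: nat pair_pre_digraph. X = iso_class G \<and> graph_sphere G \<and> pair_graph G"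
    if "X \<in> carrier sphere_monoid" for X
    using that graph_sphere_pair_graph by (auto simp: sphere_monoid_def)
  have one: "\<one>\<^bsub>sphere_monoid\<^esub> = iso_class (empty_graph :: nat pair_pre_digraph)"
    by (simp add: sphere_monoid_def)
  show ?thesis
  proof (rule comm_monoidI)
    show "\<one>\<^bsub>sphere_monoid\<^esub> \<in> carrier sphere_monoid"
      unfolding one by (intro iso_class_in_sphere_monoid graph_sphere_empty)
    fix X assume "X \<in> carrier sphere_monoid"
    then obtain G :: "nat pair_pre_digraph" where G: "X = iso_class G" "graph_sphere G" "pair_graph G"
      using carrier by blast
    show "\<one>\<^bsub>sphere_monoid\<^esub> \<otimes>\<^bsub>sphere_monoid\<^esub> X = X"
      by (simp add: one G sphere_mult graph_join_empty iso_class_map_graph)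
    fix Y assume "Y \<in> carrier sphere_monoid"
    then obtain H :: "nat pair_pre_digraph" where H: "Y = iso_class H" "graph_sphere H" "pair_graph H"
      using carrier by blast
    show "X \<otimes>\<^bsub>sphere_monoid\<^esub> Y \<in> carrier sphere_monoid"
      by (simp add: G H sphere_mult iso_class_in_sphere_monoid graph_sphere_join)
    have "inj_on (case_sum Inr Inl) (pverts (graph_join H G))"
      by (auto simp: inj_on_def)
    then show "X \<otimes>\<^bsub>sphere_monoid\<^esub> Y = Y \<otimes>\<^bsub>sphere_monoid\<^esub> X"
      by (simp add: G H sphere_mult graph_join_commute[of G H] iso_class_map_graph pair_graph_join)
    fix Z assume "Z \<in> carrier sphere_monoid"
    then obtain K :: "nat pair_pre_digraph" where K: "Z = iso_class K" "graph_sphere K" "pair_graph K"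
      using carrier by blast
    have "inj_on (case_sum (case_sum Inl (Inr \<circ> Inl)) (Inr \<circ> Inr))
        (pverts (graph_join (graph_join G H) K))"
      by (auto simp: inj_on_def)
    then show "X \<otimes>\<^bsub>sphere_monoid\<^esub> Y \<otimes>\<^bsub>sphere_monoid\<^esub> Z = X \<otimes>\<^bsub>sphere_monoid\<^esub> (Y \<otimes>\<^bsub>sphere_monoid\<^esub> Z)"
      by (simp add: G H K sphere_mult pair_graph_join graph_join_assoc iso_class_map_graph)
  qed
qed

section \<open>The Grothendieck group of a commutative monoid\<close>

lemma grothendieck_simps:
  "carrier (grothendieck_group M) = (carrier M \<times> carrier M) // grothendieck_rel M"
  "\<one>\<^bsub>grothendieck_group M\<^esub> = formal_diff M \<one>\<^bsub>M\<^esub> \<one>\<^bsub>M\<^esub>"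
  by (simp_all add: grothendieck_group_def)

context comm_monoid
begin

lemma equiv_grothendieck_rel: "equiv (carrier G \<times> carrier G) (grothendieck_rel G)"
proof (rule equivI)
  show "grothendieck_rel G \<subseteq> (carrier G \<times> carrier G) \<times> carrier G \<times> carrier G"
    by (auto simp: grothendieck_rel_def)
  show "refl_on (carrier G \<times> carrier G) (grothendieck_rel G)"
    by (auto simp: refl_on_def grothendieck_rel_def m_comm)
  show "sym (grothendieck_rel G)"
  proof (rule symI)
    fix x y assume "(x, y) \<in> grothendieck_rel G"
    then show "(y, x) \<in> grothendieck_rel G"
      unfolding grothendieck_rel_def by clarsimp (metis m_comm)
  qed
  show "trans (grothendieck_rel G)"
  proof (rule transI)
    fix x y z assume xy: "(x, y) \<in> grothendieck_rel G" and yz: "(y, z) \<in> grothendieck_rel G"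
    obtain a b c d e f where x: "x = (a, b)" and y: "y = (c, d)" and z: "z = (e, f)"
      by (metis surj_pair)
    have mem: "a \<in> carrier G" "b \<in> carrier G" "c \<in> carrier G" "d \<in> carrier G"
      "e \<in> carrier G" "f \<in> carrier G"
      using xy yz by (auto simp: grothendieck_rel_def x y z)
    obtain k where k: "k \<in> carrier G" "a \<otimes> d \<otimes> k = b \<otimes> c \<otimes> k"
      using xy by (auto simp: grothendieck_rel_def x y)
    obtain l where l: "l \<in> carrier G" "c \<otimes> f \<otimes> l = d \<otimes> e \<otimes> l"
      using yz by (auto simp: grothendieck_rel_def y z)
    \<comment> \<open>The witness is the product of \<open>d\<close>, \<open>k\<close> and
      \<open>l\<close>: keeping the middle entry \<open>d\<close> lets the two relations be applied
      in turn without cancelling it.\<close>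
    have "a \<otimes> f \<otimes> (d \<otimes> k \<otimes> l) = (a \<otimes> d \<otimes> k) \<otimes> (f \<otimes> l)"
      using mem k(1) l(1) by (simp add: m_ac)
    also have "\<dots> = (c \<otimes> f \<otimes> l) \<otimes> (b \<otimes> k)"
      unfolding k(2) using mem k(1) l(1) by (simp add: m_ac)
    also have "\<dots> = b \<otimes> e \<otimes> (d \<otimes> k \<otimes> l)"
      unfolding l(2) using mem k(1) l(1) by (simp add: m_ac)
    finally show "(x, z) \<in> grothendieck_rel G"
      using mem k(1) l(1) by (auto simp: grothendieck_rel_def x z)
  qed
qed

section \<open>Arithmetic of formal differences\<close>

lemma formal_diff_eq_iff:
  assumes "a \<in> carrier G" "b \<in> carrier G" "c \<in> carrier G" "d \<in> carrier G"
  shows "formal_diff G a b = formal_diff G c d \<longleftrightarrow> (\<exists>k\<in>carrier G. a \<otimes> d \<otimes> k = b \<otimes> c \<otimes> k)"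
proof -
  have "formal_diff G a b = formal_diff G c d \<longleftrightarrow> ((a, b), (c, d)) \<in> grothendieck_rel G"
    unfolding formal_diff_def using assms
    by (intro eq_equiv_class_iff[OF equiv_grothendieck_rel]) auto
  then show ?thesis
    using assms by (simp add: grothendieck_rel_def)
qed

lemma formal_diff_in_carrier:
  "a \<in> carrier G \<Longrightarrow> b \<in> carrier G \<Longrightarrow> formal_diff G a b \<in> carrier (grothendieck_group G)"
  by (simp add: grothendieck_simps formal_diff_def quotientI)

lemma grothendieck_cases:
  assumes "X \<in> carrier (grothendieck_group G)"
  obtains a b where "a \<in> carrier G" "b \<in> carrier G" "X = formal_diff G a b"
  using assms by (auto simp: grothendieck_simps formal_diff_def elim!: quotientE)

lemma formal_diff_mult:
  assumes "a \<in> carrier G" "b \<in> carrier G" "c \<in> carrier G" "d \<in> carrier G"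
  shows "formal_diff G a b \<otimes>\<^bsub>grothendieck_group G\<^esub> formal_diff G c d =
    formal_diff G (a \<otimes> c) (b \<otimes> d)"
proof -
  have eq: "formal_diff G (a' \<otimes> c') (b' \<otimes> d') = formal_diff G (a \<otimes> c) (b \<otimes> d)"
    if ab: "(a', b') \<in> formal_diff G a b" and cd: "(c', d') \<in> formal_diff G c d" for a' b' c' d'
  proof -
    have mem: "a' \<in> carrier G" "b' \<in> carrier G" "c' \<in> carrier G" "d' \<in> carrier G"
      using ab cd by (auto simp: formal_diff_def grothendieck_rel_def)
    obtain k where k: "k \<in> carrier G" "a \<otimes> b' \<otimes> k = b \<otimes> a' \<otimes> k"
      using ab by (auto simp: formal_diff_def grothendieck_rel_def)
    obtain l where l: "l \<in> carrier G" "c \<otimes> d' \<otimes> l = d \<otimes> c' \<otimes> l"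
      using cd by (auto simp: formal_diff_def grothendieck_rel_def)
    \<comment> \<open>The two relations are multiplied, which makes the product of their witnesses a
      witness.\<close>
    have "(a \<otimes> c) \<otimes> (b' \<otimes> d') \<otimes> (k \<otimes> l) = (a \<otimes> b' \<otimes> k) \<otimes> (c \<otimes> d' \<otimes> l)"
      using assms mem k(1) l(1) by (simp add: m_ac)
    also have "\<dots> = (b \<otimes> d) \<otimes> (a' \<otimes> c') \<otimes> (k \<otimes> l)"
      unfolding k(2) l(2) using assms mem k(1) l(1) by (simp add: m_ac)
    finally have "formal_diff G (a \<otimes> c) (b \<otimes> d) = formal_diff G (a' \<otimes> c') (b' \<otimes> d')"
      using assms mem k(1) l(1) by (subst formal_diff_eq_iff) auto
    then show ?thesis ..
  qed
  \<comment> \<open>Each class contains its own representative, so the union defining the product is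
    not over an empty family.\<close>
  have ab: "(a, b) \<in> formal_diff G a b" and cd: "(c, d) \<in> formal_diff G c d"
    using assms equiv_class_self[OF equiv_grothendieck_rel] by (auto simp: formal_diff_def)
  have "(\<Union>(a', b')\<in>formal_diff G a b. \<Union>(c', d')\<in>formal_diff G c d.
      formal_diff G (a' \<otimes> c') (b' \<otimes> d')) = formal_diff G (a \<otimes> c) (b \<otimes> d)"
    (is "?U = ?D")
  proof
    show "?U \<subseteq> ?D"
      using eq by fast
    show "?D \<subseteq> ?U"
      using ab cd by fast
  qed
  then show ?thesis
    by (simp add: grothendieck_group_def)
qed

lemma formal_diff_self:
  "a \<in> carrier G \<Longrightarrow> formal_diff G a a = \<one>\<^bsub>grothendieck_group G\<^esub>"
  unfolding grothendieck_simps(2) by (subst formal_diff_eq_iff) auto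

lemma comm_group_grothendieck_group: "comm_group (grothendieck_group G)"
proof (rule comm_groupI)
  show "\<one>\<^bsub>grothendieck_group G\<^esub> \<in> carrier (grothendieck_group G)"
    unfolding grothendieck_simps(2) by (intro formal_diff_in_carrier) auto
  fix X assume "X \<in> carrier (grothendieck_group G)"
  then obtain a b where X: "a \<in> carrier G" "b \<in> carrier G" "X = formal_diff G a b"
    by (rule grothendieck_cases)
  show "\<one>\<^bsub>grothendieck_group G\<^esub> \<otimes>\<^bsub>grothendieck_group G\<^esub> X = X"
    unfolding grothendieck_simps(2) using X by (simp add: formal_diff_mult)
  \<comment> \<open>Swapping the entries inverts a formal difference, because the product has equal
    entries.\<close>
  have "formal_diff G b a \<otimes>\<^bsub>grothendieck_group G\<^esub> X = \<one>\<^bsub>grothendieck_group G\<^esub>"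
    using X by (simp add: formal_diff_mult m_comm[of b a] formal_diff_self)
  then show "\<exists>Y\<in>carrier (grothendieck_group G). Y \<otimes>\<^bsub>grothendieck_group G\<^esub> X = \<one>\<^bsub>grothendieck_group G\<^esub>"
    using X formal_diff_in_carrier by blast
  fix Y assume "Y \<in> carrier (grothendieck_group G)"
  then obtain c d where Y: "c \<in> carrier G" "d \<in> carrier G" "Y = formal_diff G c d"
    by (rule grothendieck_cases)
  show "X \<otimes>\<^bsub>grothendieck_group G\<^esub> Y \<in> carrier (grothendieck_group G)"
    using X Y by (simp add: formal_diff_mult formal_diff_in_carrier)
  show "X \<otimes>\<^bsub>grothendieck_group G\<^esub> Y = Y \<otimes>\<^bsub>grothendieck_group G\<^esub> X"
    using X Y by (simp add: formal_diff_mult m_comm)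
  fix Z assume "Z \<in> carrier (grothendieck_group G)"
  then obtain e f where Z: "e \<in> carrier G" "f \<in> carrier G" "Z = formal_diff G e f"
    by (rule grothendieck_cases)
  show "X \<otimes>\<^bsub>grothendieck_group G\<^esub> Y \<otimes>\<^bsub>grothendieck_group G\<^esub> Z
      = X \<otimes>\<^bsub>grothendieck_group G\<^esub> (Y \<otimes>\<^bsub>grothendieck_group G\<^esub> Z)"
    using X Y Z by (simp add: formal_diff_mult m_assoc)
qed

lemma inv_formal_diff:
  assumes "a \<in> carrier G" "b \<in> carrier G"
  shows "inv\<^bsub>grothendieck_group G\<^esub> (formal_diff G a b) = formal_diff G b a"
proof -
  interpret K: comm_group "grothendieck_group G"
    by (rule comm_group_grothendieck_group)
  show ?thesis
    using assms by (intro K.inv_equality formal_diff_in_carrier)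
      (simp_all add: formal_diff_mult m_comm[of b a] formal_diff_self)
qed

end

section \<open>The Fredholm character of the sphere group\<close>

interpretation sphere_monoid: comm_monoid sphere_monoid
  by (rule comm_monoid_sphere_monoid)

lemma fredholm_char_sphere:
  assumes "graph_sphere G"
  shows "fredholm_char G = 1 \<or> fredholm_char G = -1" "fredholm_char G \<noteq> 0"
  using fredholm_char_cases[OF graph_sphere_pair_graph[OF assms]] by auto

text \<open>Well-definedness of the extension: equal differences give isomorphic joins after adding
  some sphere \<open>K\<close>, and multiplicativity turns this into an equation of signs.\<close>

lemma sphere_diff_eqD:
  assumes "graph_sphere G" "graph_sphere H" "graph_sphere G'" "graph_sphere H'"
    and eq: "sphere_diff G H = sphere_diff G' H'"
  shows "fredholm_char G * (1 / fredholm_char H) = fredholm_char G' * (1 / fredholm_char H')"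
proof -
  note spheres = assms(1-4)
  note simps = spheres graph_sphere_pair_graph graph_sphere_join pair_graph_join
  obtain k where k: "k \<in> carrier sphere_monoid"
    "iso_class G \<otimes>\<^bsub>sphere_monoid\<^esub> iso_class H' \<otimes>\<^bsub>sphere_monoid\<^esub> k
      = iso_class H \<otimes>\<^bsub>sphere_monoid\<^esub> iso_class G' \<otimes>\<^bsub>sphere_monoid\<^esub> k"
    using eq unfolding sphere_diff_def
    by (subst (asm) sphere_monoid.formal_diff_eq_iff) (auto simp: iso_class_in_sphere_monoid spheres)
  obtain K :: "nat pair_pre_digraph" where K: "graph_sphere K" "k = iso_class K"
    using k(1) by (auto simp: sphere_monoid_def)
  have "iso_class (graph_join (graph_join G H') K) = iso_class (graph_join (graph_join H G') K)"
    using k(2) K(1) by (simp add: K(2) sphere_mult simps)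
  then have "fredholm_char (graph_join (graph_join G H') K)
      = fredholm_char (graph_join (graph_join H G') K)"
    using K(1) by (intro fredholm_char_iso_class) (simp_all add: simps)
  then have "fredholm_char G * fredholm_char H' * fredholm_char K
      = fredholm_char H * fredholm_char G' * fredholm_char K"
    using K(1) by (simp add: graph_sphere_fredholm_join simps)
  \<comment> \<open>All these values are non-zero, so that of \<open>K\<close> cancels and the
    others may be divided by.\<close>
  then show ?thesis
    using K(1) spheres[THEN fredholm_char_sphere(2)] fredholm_char_sphere(2)[OF K(1)]
    by (simp add: field_simps)
qed

text \<open>The definite description ranges over spheres on \<open>nat\<close>: copies of
  \<open>G\<close> and \<open>H\<close> supply existence, and well-definedness supplies
  uniqueness.\<close>

lemma fredholm_ext_sphere_diff:
  fixes G :: "'a pair_pre_digraph" and H :: "'b pair_pre_digraph"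
  assumes G: "graph_sphere G" and H: "graph_sphere H"
  shows "fredholm_ext (sphere_diff G H) = fredholm_char G / fredholm_char H"
proof -
  obtain G' :: "nat pair_pre_digraph" where G': "graph_sphere G'" "iso_class G' = iso_class G"
    "fredholm_char G' = fredholm_char G"
    using G by (rule sphere_nat_copy)
  obtain H' :: "nat pair_pre_digraph" where H': "graph_sphere H'" "iso_class H' = iso_class H"
    "fredholm_char H' = fredholm_char H"
    using H by (rule sphere_nat_copy)
  have "sphere_diff G H = sphere_diff G' H'"
    by (simp add: sphere_diff_def G' H')
  then have "fredholm_ext (sphere_diff G H) = fredholm_char G' * (1 / fredholm_char H')"
    unfolding fredholm_ext_def
  proof (intro the_equality)
    fix r assume "\<exists>(G2 :: nat pair_pre_digraph) (H2 :: nat pair_pre_digraph).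
      graph_sphere G2 \<and> graph_sphere H2 \<and> sphere_diff G H = sphere_diff G2 H2
      \<and> r = fredholm_char G2 * (1 / fredholm_char H2)"
    then show "r = fredholm_char G' * (1 / fredholm_char H')"
      using sphere_diff_eqD G'(1) H'(1) \<open>sphere_diff G H = sphere_diff G' H'\<close> by metis
  qed (use G'(1) H'(1) in blast)
  then show ?thesis
    by (simp add: G' H')
qed

lemma sphere_group_cases:
  assumes "X \<in> carrier sphere_group"
  obtains G H :: "nat pair_pre_digraph" where "graph_sphere G" "graph_sphere H" "X = sphere_diff G H"
proof -
  obtain a b where "a \<in> carrier sphere_monoid" "b \<in> carrier sphere_monoid"
      "X = formal_diff sphere_monoid a b"
    using assms by (rule sphere_monoid.grothendieck_cases)
  then show thesis
    using that by (auto simp: sphere_monoid_def sphere_diff_def)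
qed

lemma sphere_diff_mult:
  assumes "graph_sphere G" "graph_sphere H" "graph_sphere G'" "graph_sphere H'"
  shows "sphere_diff G H \<otimes>\<^bsub>sphere_group\<^esub> sphere_diff G' H' =
    sphere_diff (graph_join G G') (graph_join H H')"
  using assms by (simp add: sphere_diff_def sphere_monoid.formal_diff_mult sphere_mult
      iso_class_in_sphere_monoid graph_sphere_pair_graph)

lemma group_sign_group: "group sign_group"
  by (rule groupI) (auto simp: sign_group_def)

text \<open>Formal differences multiply by joining entries, where the Fredholm characteristic is
  multiplicative; a quotient of two signs is again a sign.\<close>

lemma group_hom_fredholm_ext: "group_hom sphere_group sign_group fredholm_ext"
proof -
  have "fredholm_ext \<in> hom sphere_group sign_group"
  proof (rule homI)
    fix X assume "X \<in> carrier sphere_group"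
    then obtain G H :: "nat pair_pre_digraph" where X: "graph_sphere G" "graph_sphere H"
        "X = sphere_diff G H"
      by (rule sphere_group_cases)
    show "fredholm_ext X \<in> carrier sign_group"
      using fredholm_char_sphere(1)[OF X(1)] fredholm_char_sphere(1)[OF X(2)] X
      by (auto simp: fredholm_ext_sphere_diff sign_group_def)
    fix Y assume "Y \<in> carrier sphere_group"
    then obtain G' H' :: "nat pair_pre_digraph" where Y: "graph_sphere G'" "graph_sphere H'"
        "Y = sphere_diff G' H'"
      by (rule sphere_group_cases)
    show "fredholm_ext (X \<otimes>\<^bsub>sphere_group\<^esub> Y) = fredholm_ext X \<otimes>\<^bsub>sign_group\<^esub> fredholm_ext Y"
      using X Y by (simp add: sphere_diff_mult fredholm_ext_sphere_diff graph_sphere_join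
          graph_sphere_fredholm_join sign_group_def)
  qed
  then show ?thesis
    using sphere_monoid.comm_group_grothendieck_group group_sign_group
    by (simp add: group_hom_def group_hom_axioms_def comm_group_def)
qed

theorem corollary7:
  shows "even (euler_char (empty_graph :: 'a pair_pre_digraph)) \<and>
    (\<forall>(G :: 'a pair_pre_digraph) (H :: 'b pair_pre_digraph).
       pair_graph G \<longrightarrow> pair_graph H \<longrightarrow> even (euler_char G) \<longrightarrow> even (euler_char H) \<longrightarrow>
         even (euler_char (graph_join G H)) \<and>
         fredholm_char (graph_join G H) = fredholm_char G * fredholm_char H) \<and>
    (\<forall>(G :: 'a pair_pre_digraph) (H :: 'b pair_pre_digraph).
       graph_sphere G \<longrightarrow> graph_sphere H \<longrightarrow>
         even (euler_char G) \<and> even (euler_char H) \<and>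
         fredholm_char (graph_join G H) = fredholm_char G * fredholm_char H) \<and>
    group_hom sphere_group sign_group fredholm_ext \<and>
    (\<forall>G :: 'a pair_pre_digraph. graph_sphere G \<longrightarrow>
       sphere_elem G \<in> carrier sphere_group \<and>
       fredholm_ext (sphere_elem G) = fredholm_char G \<and>
       fredholm_ext (inv\<^bsub>sphere_group\<^esub> (sphere_elem G)) = 1 / fredholm_char G)"
proof -
  have "sphere_elem G \<in> carrier sphere_group \<and>
       fredholm_ext (sphere_elem G) = fredholm_char G \<and>
       fredholm_ext (inv\<^bsub>sphere_group\<^esub> (sphere_elem G)) = 1 / fredholm_char G"
    if G: "graph_sphere G" for G :: "'a pair_pre_digraph"
  proof -
    let ?E = "empty_graph :: nat pair_pre_digraph"
    note mem = iso_class_in_sphere_monoid[OF G] iso_class_in_sphere_monoid[OF graph_sphere_empty]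
    \<comment> \<open>The inverse of G - 0 is 0 - G. Since the Fredholm characteristic of the empty
      graph is the empty product 1, the extension takes the reciprocal value there.\<close>
    have "inv\<^bsub>sphere_group\<^esub> (sphere_elem G) = sphere_diff ?E G"
      unfolding sphere_diff_def by (rule sphere_monoid.inv_formal_diff[OF mem])
    moreover have "sphere_elem G \<in> carrier sphere_group"
      unfolding sphere_diff_def by (rule sphere_monoid.formal_diff_in_carrier[OF mem])
    ultimately show ?thesis
      by (simp add: fredholm_ext_sphere_diff G graph_sphere_empty)
  qed
  then show ?thesis
    using group_hom_fredholm_ext
    by (simp add: even_euler_char_join fredholm_char_join graph_sphere_even_euler_char
        graph_sphere_fredholm_join)
qed

end
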